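(* Let $n$ be a nonzero integer, written as $n=2^j\cdot m$ with $j\ge 0$ an integer and $m$ odd, and let $i$ be an integer with $j<i$. Then $$f(n,i) = f(n-2^j,i) + f(n+2^j,i).$$
   Context: For an integer $n$ and an integer $i\ge 0$, $f(n,i)$ denotes the number of binary signed-digit (BSD) representations of $n$ on $i$ bits, i.e. the number of tuples $(b_{i-1},\dots,b_0)\in\{1,0,-1\}^i$ with $n=\sum_{j=0}^{i-1} b_j 2^j$. *)

theory Defs
  imports Main
begin

(* The tuple (b_{i-1}, ..., b_0) is stored least significant digit first: bs ! k is b_k. *)
definition bsd_reps :: "int \<Rightarrow> nat \<Rightarrow> int list set" where
  "bsd_reps n i =
     {bs. length bs = i \<and> set bs \<subseteq> {1, 0, -1} \<and> n = (\<Sum>k<i. bs ! k * 2 ^ k)}"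

definition bsd_count :: "int \<Rightarrow> nat \<Rightarrow> nat" where
  "bsd_count n i = card (bsd_reps n i)"

end

theory Submission
  imports Defs
begin

text \<open>Removing the least significant digit \<open>d\<close> leaves a representation of
  \<open>(n - d) / 2\<close> on one bit fewer. Parity controls \<open>d\<close>: an even number
  forces 0 (\<open>bsd_count_double\<close>), an odd one allows exactly 1 and -1
  (\<open>bsd_count_double_plus_one\<close>). For odd \<open>n = 2 * q + 1\<close> the two resulting
  counts, of \<open>q\<close> and \<open>q + 1\<close>, are those of the even neighbours
  \<open>n - 1\<close> and \<open>n + 1\<close>. A factor \<open>2 ^ j\<close> is removed by halving
  all three numbers \<open>j\<close> times.\<close>

text \<open>Horner's rule: with the lowest digit at the head, the tail carries weight 2.\<close>

lemma Cons_in_bsd_reps_iff: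
  "d # bs \<in> bsd_reps n (Suc i) \<longleftrightarrow>
     d \<in> {1, 0, -1} \<and> (\<exists>q. n = 2 * q + d \<and> bs \<in> bsd_reps q i)"
  by (auto simp: bsd_reps_def sum.lessThan_Suc_shift sum_distrib_left mult_ac simp del: sum.lessThan_Suc)

lemma bsd_reps_Suc_cases:
  assumes "bs \<in> bsd_reps n (Suc i)"
  obtains d cs where "bs = d # cs"
  using assms by (cases bs) (auto simp: bsd_reps_def)

lemma finite_bsd_reps: "finite (bsd_reps n i)"
proof (rule finite_subset)
  show "bsd_reps n i \<subseteq> {bs. set bs \<subseteq> {1, 0, -1} \<and> length bs = i}"
    by (auto simp: bsd_reps_def)
qed (simp add: finite_lists_length_eq)

text \<open>The last digit must be even, hence 0, so prepending 0 is a bijection.\<close>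

lemma bsd_count_double: "bsd_count (2 * n) (Suc i) = bsd_count n i"
proof -
  have "bsd_reps (2 * n) (Suc i) = (#) 0 ` bsd_reps n i"
  proof (intro set_eqI iffI)
    fix bs assume bs: "bs \<in> bsd_reps (2 * n) (Suc i)"
    then obtain d cs where [simp]: "bs = d # cs" by (rule bsd_reps_Suc_cases)
    from bs obtain q where "d \<in> {1, 0, -1}" "2 * n = 2 * q + d" "cs \<in> bsd_reps q i"
      by (auto simp: Cons_in_bsd_reps_iff)
    moreover from this have "d = 0" "q = n" by (auto, presburger+)
    ultimately show "bs \<in> (#) 0 ` bsd_reps n i" by simp
  qed (auto simp: Cons_in_bsd_reps_iff)
  then show ?thesis by (simp add: bsd_count_def card_image)
qed

text \<open>The last digit is 1 or -1, leaving \<open>n\<close> or \<open>n + 1\<close> for the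
  higher digits; the head digit keeps the two cases disjoint.\<close>

lemma bsd_count_double_plus_one:
  "bsd_count (2 * n + 1) (Suc i) = bsd_count n i + bsd_count (n + 1) i"
proof -
  have "bsd_reps (2 * n + 1) (Suc i) = (#) 1 ` bsd_reps n i \<union> (#) (-1) ` bsd_reps (n + 1) i"
  proof (intro set_eqI iffI)
    fix bs assume bs: "bs \<in> bsd_reps (2 * n + 1) (Suc i)"
    then obtain d cs where [simp]: "bs = d # cs" by (rule bsd_reps_Suc_cases)
    from bs obtain q where "d \<in> {1, 0, -1}" "2 * n + 1 = 2 * q + d" "cs \<in> bsd_reps q i"
      by (auto simp: Cons_in_bsd_reps_iff)
    moreover from this have "d = 1 \<and> q = n \<or> d = -1 \<and> q = n + 1" by (auto, presburger+)
    ultimately show "bs \<in> (#) 1 ` bsd_reps n i \<union> (#) (-1) ` bsd_reps (n + 1) i" by auto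
  \<comment> \<open>The witness serves digit -1: \<open>2 * n + 1 = 2 * (n + 1) - 1\<close>.\<close>
  qed (auto simp: Cons_in_bsd_reps_iff intro!: exI[of _ "n + 1"])
  moreover have "(#) 1 ` bsd_reps n i \<inter> (#) (-1) ` bsd_reps (n + 1) i = {}" by auto
  ultimately show ?thesis
    by (simp add: bsd_count_def card_Un_disjoint finite_bsd_reps card_image)
qed

theorem theorem6:
  fixes n m :: int and i j :: nat
  assumes "n \<noteq> 0" and "n = 2 ^ j * m" and "odd m" and "j < i"
  shows "bsd_count n i = bsd_count (n - 2 ^ j) i + bsd_count (n + 2 ^ j) i"
  using \<open>n = 2 ^ j * m\<close> \<open>j < i\<close>
\<comment> \<open>Each step halves \<open>n\<close> and drops a bit, so both vary while the odd part
  \<open>m\<close> stays fixed.\<close>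
proof (induction j arbitrary: n i)
  case 0
  from \<open>odd m\<close> obtain q where "m = 2 * q + 1" by (rule oddE)
  with 0 obtain i' where "n = 2 * q + 1" "i = Suc i'" by (cases i) auto
  \<comment> \<open>Here \<open>n - 1 = 2 * q\<close> and
    \<open>n + 1 = 2 * (q + 1)\<close>.\<close>
  then show ?case
    using bsd_count_double[of q i'] bsd_count_double[of "q + 1" i']
      bsd_count_double_plus_one[of q i']
    by (simp add: add.commute)
next
  case (Suc j)
  then obtain i' where "i = Suc i'" "j < i'" by (cases i) auto
  define q where "q = 2 ^ j * m"
  \<comment> \<open>All three arguments are even, so each loses a final 0.\<close>
  have "n = 2 * q" "n - 2 ^ Suc j = 2 * (q - 2 ^ j)" "n + 2 ^ Suc j = 2 * (q + 2 ^ j)"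
    using Suc.prems by (simp_all add: q_def algebra_simps)
  with Suc.IH[OF q_def \<open>j < i'\<close>] \<open>i = Suc i'\<close> show ?case
    by (simp only: bsd_count_double)
qed

end
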